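(* For every fixed integer $r\geq 1$ and every $\epsilon>0$, for all sufficiently large $k$, $$AW(k;r)\geq \frac{k^{2r-1-\epsilon}}{2^{r-1}(40r)^{r^2-1}}.$$
   Context: A sequence of positive integers $w_1<\dots<w_n$ is an ascending wave if $w_{i+1}-w_i \geq w_i-w_{i-1}$ for $2\le i\le n-1$. For positive integers $k,r$, $AW(k;r)$ denotes the least positive integer $N$ such that every $r$-coloring of $\{1,\dots,N\}$ contains a $k$-term monochromatic ascending wave. *)

theory Defs
  imports "HOL-Analysis.Analysis"
begin

definition ascending_wave :: "nat list \<Rightarrow> bool" where
  "ascending_wave w \<longleftrightarrow>
     (\<forall>i. i < length w \<longrightarrow> 0 < w ! i) \<and>
     (\<forall>i. i + 1 < length w \<longrightarrow> w ! i < w ! (i + 1)) \<and>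
     (\<forall>i. 0 < i \<and> i + 1 < length w \<longrightarrow> w ! (i + 1) - w ! i \<ge> w ! i - w ! (i - 1))"

definition has_mono_wave :: "nat \<Rightarrow> nat \<Rightarrow> (nat \<Rightarrow> nat) \<Rightarrow> bool" where
  "has_mono_wave k N c \<longleftrightarrow>
     (\<exists>w. length w = k \<and> ascending_wave w \<and> set w \<subseteq> {1..N} \<and>
          (\<forall>x\<in>set w. \<forall>y\<in>set w. c x = c y))"

definition AW :: "nat \<Rightarrow> nat \<Rightarrow> nat" where
  "AW k r = (LEAST N. 0 < N \<and>
     (\<forall>c. (\<forall>x\<in>{1..N}. c x < r) \<longrightarrow> has_mono_wave k N c))"

end

theory Submission
  imports Defs "HOL-Real_Asymp.Real_Asymp"
begin

text \<open>
  The constant in the denominator is at least \<open>1\<close>, so it suffices to find, for every \<open>s < 2r - 1\<close>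
  and all large \<open>k\<close>, an \<open>r\<close>-coloring of an interval of length \<open>k powr s\<close> without a monochromatic
  \<open>k\<close>-term wave; this goes by induction on \<open>r\<close>. Cut the interval into \<open>k powr (2 - o(1))\<close> blocks
  of length \<open>M\<close>. Every block omits one of the \<open>r + 1\<close> colors, chosen at random, and carries a copy
  of an \<open>r\<close>-coloring in the other colors without waves of \<open>m = k powr (1 - o(1))\<close> terms. With
  \<open>l = k powr o(1)\<close>, a union bound shows that for some choice of the omitted colors, every
  \<open>l\<close>-term arithmetic progression with difference at least \<open>2M\<close> has, for every color \<open>c\<close>, a term
  whose block and the next block both omit \<open>c\<close>.

  A wave of color \<open>c\<close> stays in each block for at most \<open>m\<close> terms, so it soon has to jump across two
  blocks that omit \<open>c\<close>, and from then on its gaps are at least \<open>2M\<close>. As the total length bounds the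
  gaps, some window of \<open>l\<close> consecutive terms has gaps growing by at most \<open>M / l\<close>. There the wave
  stays within \<open>M\<close> above an arithmetic progression, and so it hits a block omitting \<open>c\<close>, a
  contradiction.
\<close>

section \<open>Waves and their gaps\<close>

definition wave :: "nat \<Rightarrow> (nat \<Rightarrow> nat) \<Rightarrow> bool" where
  "wave k w \<longleftrightarrow> (\<forall>i. Suc i < k \<longrightarrow> w i < w (Suc i)) \<and>
     (\<forall>i. Suc (Suc i) < k \<longrightarrow> 2 * w (Suc i) \<le> w i + w (Suc (Suc i)))"

definition gap :: "(nat \<Rightarrow> nat) \<Rightarrow> nat \<Rightarrow> nat" where
  "gap w i = w (Suc i) - w i"

lemma wave_Suc: "wave k w \<Longrightarrow> Suc i < k \<Longrightarrow> w (Suc i) = w i + gap w i"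
  by (auto simp: wave_def gap_def)

lemma wave_gap_mono:
  assumes "wave k w" "i \<le> j" "Suc j < k"
  shows "gap w i \<le> gap w j"
  using assms(2,3)
proof (induction j rule: dec_induct)
  case (step j)
  have "w j < w (Suc j)" "2 * w (Suc j) \<le> w j + w (Suc (Suc j))"
    using assms(1) step.prems by (auto simp: wave_def)
  then have "gap w j \<le> gap w (Suc j)"
    unfolding gap_def by linarith
  with step show ?case by simp
qed simp

lemma wave_lower:
  assumes "wave k w" "s + i < k"
  shows "w s + i * gap w s \<le> w (s + i)"
  using assms(2)
proof (induction i)
  case (Suc i)
  have "gap w s \<le> gap w (s + i)"
    using Suc.prems by (intro wave_gap_mono[OF assms(1)]) auto
  with Suc wave_Suc[OF assms(1), of "s + i"] show ?case by simp
qed simp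

lemma wave_upper:
  assumes "wave k w" "s + i \<le> j" "Suc j < k"
  shows "w (s + i) \<le> w s + i * gap w j"
  using assms(2)
proof (induction i)
  case (Suc i)
  have "gap w (s + i) \<le> gap w j"
    using Suc.prems assms(3) by (intro wave_gap_mono[OF assms(1)]) auto
  with Suc assms(3) wave_Suc[OF assms(1), of "s + i"] show ?case by simp
qed simp

lemma wave_mono:
  assumes "wave k w" "i \<le> j" "j < k"
  shows "w i \<le> w j"
  using wave_lower[OF assms(1), of i "j - i"] assms(2,3) by simp

lemma wave_shift:
  assumes "wave k w" "s + m \<le> k" "\<And>i. i < m \<Longrightarrow> a \<le> w (s + i)"
  shows "wave m (\<lambda>i. w (s + i) - a)"
  unfolding wave_def
proof (intro conjI allI impI)
  fix i assume index: "Suc i < m"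
  have "w (s + i) < w (Suc (s + i))"
    using assms(1,2) index by (auto simp: wave_def)
  with assms(3)[of i] index show "w (s + i) - a < w (s + Suc i) - a" by simp
next
  fix i assume index: "Suc (Suc i) < m"
  have "2 * w (Suc (s + i)) \<le> w (s + i) + w (Suc (Suc (s + i)))"
    using assms(1,2) index by (auto simp: wave_def)
  with assms(3)[of i] assms(3)[of "Suc i"] assms(3)[of "Suc (Suc i)"] index
  show "2 * (w (s + Suc i) - a) \<le> w (s + i) - a + (w (s + Suc (Suc i)) - a)" by simp
qed

lemma wave_gap_ge_avoided_interval:
  assumes wave: "wave k w" and "Suc t < k" "w 0 < x" "y \<le> w t"
    and avoid: "\<And>i. i \<le> t \<Longrightarrow> w i \<notin> {x..<y}"
  shows "y - x \<le> gap w t"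
proof (cases "x \<le> y")
  case True
  then have "x \<le> w t" using \<open>y \<le> w t\<close> by simp
  define j where "j = (LEAST j. x \<le> w j)"
  have "x \<le> w j" "j \<le> t"
    unfolding j_def using \<open>x \<le> w t\<close> by (rule LeastI, rule Least_le)
  then have "y \<le> w j" using avoid[of j] by auto
  have "j \<noteq> 0" using \<open>x \<le> w j\<close> \<open>w 0 < x\<close> by (auto intro: Nat.gr0I)
  then obtain i where j_Suc: "j = Suc i" by (cases j) auto
  then have "w i < x" using not_less_Least[of i "\<lambda>j. x \<le> w j"] j_def by simp
  with \<open>y \<le> w j\<close> have "y - x \<le> gap w i" by (simp add: gap_def j_Suc)
  also have "\<dots> \<le> gap w t"
    using \<open>j \<le> t\<close> \<open>Suc t < k\<close> j_Suc by (intro wave_gap_mono[OF wave]) auto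
  finally show ?thesis .
qed simp

text \<open>
  Without such a window \<open>l * gap w\<close> would grow by more than \<open>D\<close> over each of \<open>W\<close> consecutive
  windows, and the \<open>R\<close> terms after them would overshoot \<open>N\<close>.
\<close>

lemma wave_slow_window:
  assumes wave: "wave k w" and bounded: "\<And>i. i < k \<Longrightarrow> w i \<le> N"
    and index: "t + W * l + R < k" and short: "l * N < W * R * D"
  obtains s where "t \<le> s" "s + l \<le> t + W * l" "l * gap w (s + l) \<le> l * gap w s + D"
proof -
  have "\<exists>j<W. l * gap w (t + Suc j * l) \<le> l * gap w (t + j * l) + D"
  proof (rule ccontr)
    assume "\<not> ?thesis"
    then have growth: "l * gap w (t + j * l) + D \<le> l * gap w (t + Suc j * l)" if "j < W" for j
      using that by force
    have "j * D \<le> l * gap w (t + j * l)" if "j \<le> W" for j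
      using that
    proof (induction j)
      case (Suc j)
      with growth[of j] show ?case by simp
    qed simp
    then have "W * D \<le> l * gap w (t + W * l)" by simp
    then have "R * (W * D) \<le> R * (l * gap w (t + W * l))" by (rule mult_le_mono2)
    also have "\<dots> = l * (R * gap w (t + W * l))" by simp
    also have "\<dots> \<le> l * N"
      using wave_lower[OF wave index] bounded[OF index] by (intro mult_le_mono2) simp
    finally show False using short by (simp add: ac_simps)
  qed
  then obtain j where "j < W" and slow: "l * gap w (t + Suc j * l) \<le> l * gap w (t + j * l) + D"
    by blast
  then have "Suc j * l \<le> W * l" by (intro mult_le_mono1) simp
  with slow show ?thesis
    by (intro that[of "t + j * l"]) (simp_all add: ac_simps)
qed

lemma wave_near_progression:
  assumes wave: "wave k w" and "Suc (s + l) < k" "i \<le> l"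
    and slow: "l * gap w (s + l) \<le> l * gap w s + D"
  shows "w (s + i) \<le> w s + i * gap w s + D"
proof -
  have "gap w s \<le> gap w (s + l)" using assms(2) by (intro wave_gap_mono[OF wave]) auto
  then obtain h where h: "gap w (s + l) = gap w s + h" using le_Suc_ex by blast
  have "i * h \<le> l * h" using \<open>i \<le> l\<close> by simp
  also have "\<dots> \<le> D" using slow by (simp add: h distrib_left)
  finally have "i * gap w (s + l) \<le> i * gap w s + D" by (simp add: h distrib_left)
  moreover have "w (s + i) \<le> w s + i * gap w (s + l)"
    using assms(2,3) by (intro wave_upper[OF wave]) auto
  ultimately show ?thesis by linarith
qed

section \<open>Wave-free colorings and \<open>AW\<close>\<close>

definition mono_wave :: "nat \<Rightarrow> (nat \<Rightarrow> nat) \<Rightarrow> nat \<Rightarrow> (nat \<Rightarrow> nat) \<Rightarrow> bool" where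
  "mono_wave k f c w \<longleftrightarrow> wave k w \<and> (\<forall>i<k. f (w i) = c)"

text \<open>Intervals are \<open>{0..<N}\<close> here, which suits \<open>div\<close> and \<open>mod\<close>, but \<open>{1..N}\<close> in \<open>AW\<close>.\<close>

definition wave_free :: "nat \<Rightarrow> nat \<Rightarrow> (nat \<Rightarrow> nat) \<Rightarrow> bool" where
  "wave_free k N f \<longleftrightarrow> (\<nexists>w c. mono_wave k f c w \<and> (\<forall>i<k. w i < N))"

definition wave_colorable :: "nat \<Rightarrow> nat \<Rightarrow> nat \<Rightarrow> bool" where
  "wave_colorable k r N \<longleftrightarrow> (\<exists>f. (\<forall>x<N. f x < r) \<and> wave_free k N f)"

lemma wave_colorable_mono: "wave_colorable k r N \<Longrightarrow> N' \<le> N \<Longrightarrow> wave_colorable k r N'"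
  unfolding wave_colorable_def wave_free_def by (metis order_less_le_trans)

lemma wave_colorable_one:
  assumes "N < k"
  shows "wave_colorable k 1 N"
proof -
  have False if wave: "wave k w" and bounded: "\<forall>i<k. w i < N" for w
  proof -
    have "i \<le> w i" if "i < k" for i
      using that
    proof (induction i)
      case (Suc i)
      with wave have "w i < w (Suc i)" by (simp add: wave_def)
      with Suc show ?case by simp
    qed simp
    from this[OF assms] bounded assms show False by fastforce
  qed
  then show ?thesis
    unfolding wave_colorable_def wave_free_def mono_wave_def
    by (intro exI[of _ "\<lambda>_. 0"]) auto
qed

lemma ascending_wave_imp_wave:
  assumes "ascending_wave w"
  shows "wave (length w) (\<lambda>i. w ! i)"
  unfolding wave_def
proof (intro conjI allI impI)
  fix i assume index: "Suc (Suc i) < length w"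
  have "w ! i < w ! Suc i" "w ! Suc i < w ! Suc (Suc i)"
    using assms index unfolding ascending_wave_def by auto
  moreover have "w ! Suc i - w ! i \<le> w ! Suc (Suc i) - w ! Suc i"
    using assms index unfolding ascending_wave_def
    by (metis Suc_eq_plus1 diff_Suc_1 zero_less_Suc)
  ultimately show "2 * w ! Suc i \<le> w ! i + w ! Suc (Suc i)" by linarith
qed (use assms in \<open>auto simp: ascending_wave_def\<close>)

lemma ascending_wave_two_powers:
  assumes "sorted_wrt (<) xs"
  shows "ascending_wave (map (\<lambda>i. 2 ^ i) xs)"
proof -
  have less: "xs ! i < xs ! Suc i" if "Suc i < length xs" for i
    using assms that by (simp add: sorted_wrt_nth_less)
  have "2 ^ (xs ! i) - a \<le> 2 ^ (xs ! Suc i) - (2::nat) ^ (xs ! i)" if "Suc i < length xs" for i a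
    using power_increasing[of "Suc (xs ! i)" "xs ! Suc i" "2::nat"] less[OF that] by simp
  then show ?thesis
    unfolding ascending_wave_def using less by auto
qed

text \<open>Ensures that the \<open>LEAST\<close> in the definition of \<open>AW\<close> is attained.\<close>

lemma has_mono_wave_two_power:
  assumes colors: "\<forall>x\<in>{1..2 ^ (r * k)}. c x < r"
  shows "has_mono_wave k (2 ^ (r * k)) c"
proof -
  let ?fibre = "\<lambda>j. (\<lambda>i. c (2 ^ i)) -` {j} \<inter> {..<r * k}"
  have "c (2 ^ i) < r" if "i < r * k" for i
    using colors that by (simp add: power_increasing)
  moreover have "0 < r" using colors by fastforce
  ultimately have "\<exists>j\<in>{..<r}. card {..<r * k} \<le> card (?fibre j) * card {..<r}"
    by (intro pigeonhole_card) auto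
  then obtain j where "k \<le> card (?fibre j)"
    using \<open>0 < r\<close> by auto
  then obtain S where S: "S \<subseteq> ?fibre j" "card S = k" "finite S"
    by (rule obtain_subset_with_card_n)
  define w where "w = map (\<lambda>i. 2 ^ i :: nat) (sorted_list_of_set S)"
  have "length w = k" using S(2) by (simp add: w_def)
  moreover have "ascending_wave w"
    unfolding w_def by (intro ascending_wave_two_powers) simp
  moreover have "set w \<subseteq> {1..2 ^ (r * k)}" "\<forall>x\<in>set w. c x = j"
    using S(1,3) by (auto simp: w_def)
  ultimately show ?thesis
    unfolding has_mono_wave_def by metis
qed

lemma has_mono_wave_imp_mono_wave:
  assumes "has_mono_wave k N (\<lambda>x. f (x - 1))"
  shows "\<exists>w c. mono_wave k f c w \<and> (\<forall>i<k. w i < N)"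
proof -
  obtain w where w: "length w = k" "ascending_wave w" "set w \<subseteq> {1..N}"
    and mono: "\<And>x y. x \<in> set w \<Longrightarrow> y \<in> set w \<Longrightarrow> f (x - 1) = f (y - 1)"
    using assms unfolding has_mono_wave_def by blast
  have mem: "w ! i \<in> set w" if "i < k" for i using w(1) that by simp
  have range: "1 \<le> w ! i" "w ! i \<le> N" if "i < k" for i
    using subsetD[OF w(3) mem[OF that]] by simp_all
  define c where "c = f (w ! 0 - 1)"
  have "wave k (\<lambda>i. w ! i - 1)"
    using wave_shift[of k "(!) w" 0 k 1] ascending_wave_imp_wave[OF w(2)] w(1) range(1)
    by simp
  moreover have "f (w ! i - 1) = c" if "i < k" for i
    unfolding c_def using that by (intro mono mem) auto
  moreover have "w ! i - 1 < N" if "i < k" for i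
    using range[OF that] by simp
  ultimately show ?thesis
    unfolding mono_wave_def
    by (intro exI[of _ "\<lambda>i. w ! i - 1"] exI[of _ c]) simp
qed

lemma less_AW:
  assumes "wave_colorable k r N"
  shows "N < AW k r"
proof (rule ccontr)
  assume "\<not> N < AW k r"
  obtain f where colors: "\<And>x. x < N \<Longrightarrow> f x < r" and free: "wave_free k N f"
    using assms unfolding wave_colorable_def by blast
  let ?P = "\<lambda>N. 0 < N \<and> (\<forall>c. (\<forall>x\<in>{1..N}. c x < r) \<longrightarrow> has_mono_wave k N c)"
  have "?P (2 ^ (r * k))" using has_mono_wave_two_power by simp
  then have "?P (AW k r)" unfolding AW_def by (rule LeastI)
  moreover have "\<forall>x\<in>{1..AW k r}. f (x - 1) < r" using colors \<open>\<not> N < AW k r\<close> by auto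
  ultimately have "has_mono_wave k (AW k r) (\<lambda>x. f (x - 1))" by simp
  then obtain w c where w: "mono_wave k f c w" "\<forall>i<k. w i < AW k r"
    using has_mono_wave_imp_mono_wave by blast
  then have "\<forall>i<k. w i < N" using \<open>\<not> N < AW k r\<close> by auto
  with w(1) free show False unfolding wave_free_def by blast
qed

section \<open>Coloring blocks\<close>

definition skip :: "nat \<Rightarrow> nat \<Rightarrow> nat" where
  "skip c x = (if x < c then x else Suc x)"

lemma skip_neq: "skip c x \<noteq> c"
  by (simp add: skip_def)

lemma skip_inj: "skip c x = skip c y \<Longrightarrow> x = y"
  by (auto simp: skip_def split: if_splits)

lemma skip_less: "x < r \<Longrightarrow> skip c x < Suc r"
  by (simp add: skip_def)

definition block_coloring :: "nat \<Rightarrow> (nat \<Rightarrow> nat) \<Rightarrow> (nat \<Rightarrow> nat) \<Rightarrow> nat \<Rightarrow> nat" where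
  "block_coloring M g \<phi> x = skip (g (x div M)) (\<phi> (x mod M))"

lemma mono_wave_avoids:
  assumes "mono_wave k (block_coloring M g \<phi>) c w" "i < k"
  shows "g (w i div M) \<noteq> c"
  using assms by (auto simp: mono_wave_def block_coloring_def skip_neq)

lemma mono_wave_leaves_block:
  assumes mono: "mono_wave k (block_coloring M g \<phi>) c w" and free: "wave_free m M \<phi>"
    and "0 < M" and index: "s + m < k"
  shows "w s div M < w (s + m) div M"
proof (rule ccontr)
  have wave: "wave k w" using mono by (simp add: mono_wave_def)
  assume "\<not> w s div M < w (s + m) div M"
  then have same: "w (s + i) div M = w s div M" if "i \<le> m" for i
    using div_le_mono[OF wave_mono[OF wave, of s "s + i"], of M]
      div_le_mono[OF wave_mono[OF wave, of "s + i" "s + m"], of M] index that by simp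
  define v where "v i = w (s + i) - w s div M * M" for i
  have v_mod: "v i = w (s + i) mod M" if "i \<le> m" for i
    using same[OF that] by (simp add: v_def modulo_nat_def)
  have "block_coloring M g \<phi> (w (s + i)) = c" if "i \<le> m" for i
    using mono index that by (simp add: mono_wave_def)
  then have colored: "skip (g (w s div M)) (\<phi> (v i)) = c" if "i \<le> m" for i
    using that by (simp add: block_coloring_def same v_mod)
  define c' where "c' = \<phi> (v 0)"
  have "wave m v"
    unfolding v_def
  proof (rule wave_shift[OF wave])
    fix i assume "i < m"
    then show "w s div M * M \<le> w (s + i)"
      using same[of i] by (metis div_times_less_eq_dividend less_imp_le)
  qed (use index in simp)
  moreover have "\<phi> (v i) = c'" if "i < m" for i
    using colored[of i] colored[of 0] that unfolding c'_def
    by (metis less_imp_le skip_inj zero_le)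
  ultimately have "mono_wave m \<phi> c' v" by (simp add: mono_wave_def)
  moreover have "\<forall>i<m. v i < M" using v_mod \<open>0 < M\<close> by simp
  ultimately show False using free unfolding wave_free_def by blast
qed

lemma mono_wave_climbs_blocks:
  assumes mono: "mono_wave k (block_coloring M g \<phi>) c w" and free: "wave_free m M \<phi>"
    and "0 < M" "j * m < k"
  shows "w 0 div M + j \<le> w (j * m) div M"
  using assms(4)
proof (induction j)
  case (Suc j)
  then have "j * m + m < k" by simp
  from mono_wave_leaves_block[OF mono free assms(3) this] Suc show ?case
    by (simp add: add.commute)
qed simp

definition double_omission :: "nat \<Rightarrow> (nat \<Rightarrow> nat) \<Rightarrow> nat \<Rightarrow> nat \<Rightarrow> bool" where
  "double_omission M g c x \<longleftrightarrow> g (x div M) = c \<and> g (Suc (x div M)) = c"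

lemma double_omission_near:
  assumes "double_omission M g c x" "x \<le> y" "y \<le> x + M"
  shows "g (y div M) = c"
proof -
  have "y div M = x div M \<or> y div M = Suc (x div M)"
  proof (cases "M = 0")
    case False
    then have "y div M \<le> Suc (x div M)" using div_le_mono[OF assms(3), of M] by simp
    with div_le_mono[OF assms(2), of M] show ?thesis by linarith
  qed simp
  with assms(1) show ?thesis by (auto simp: double_omission_def)
qed

lemma double_omission_gap:
  assumes mono: "mono_wave k (block_coloring M g \<phi>) c w" and "0 < M" and index: "Suc t < k"
    and omit: "double_omission M g c x" and between: "w 0 div M \<le> x div M" "x div M < w t div M"
  shows "2 * M \<le> gap w t"
proof -
  define b where "b = x div M"
  have avoid: "w i div M \<noteq> b" "w i div M \<noteq> Suc b" if "i < k" for i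
    using mono_wave_avoids[OF mono that] omit by (auto simp: double_omission_def b_def)
  have "wave k w" using mono by (simp add: mono_wave_def)
  then have "(b + 2) * M - b * M \<le> gap w t"
  proof (rule wave_gap_ge_avoided_interval[OF _ index])
    have "w 0 div M < b" using between(1) avoid(1)[of 0] index by (simp add: b_def)
    then show "w 0 < b * M" using \<open>0 < M\<close> by (simp only: div_less_iff_less_mult)
    have "b + 2 \<le> w t div M" using between(2) avoid(2)[of t] index by (simp add: b_def)
    then show "(b + 2) * M \<le> w t" using \<open>0 < M\<close> by (simp only: less_eq_div_iff_mult_less_eq)
    fix i assume "i \<le> t"
    then have "w i div M < b \<or> b + 2 \<le> w i div M"
      using avoid[of i] index by linarith
    then show "w i \<notin> {b * M..<(b + 2) * M}"
      using \<open>0 < M\<close>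
      by (auto simp only: div_less_iff_less_mult less_eq_div_iff_mult_less_eq atLeastLessThan_iff)
  qed
  then show ?thesis by (simp add: algebra_simps)
qed

definition hits_progressions :: "nat \<Rightarrow> nat \<Rightarrow> nat \<Rightarrow> nat \<Rightarrow> (nat \<Rightarrow> nat) \<Rightarrow> bool" where
  "hits_progressions n M l N g \<longleftrightarrow>
     (\<forall>c<n. \<forall>a\<le>N. \<forall>d\<in>{2 * M..N}. \<exists>i<l. double_omission M g c (a + i * d))"

lemma hits_progressionsE:
  assumes "hits_progressions n M l N g" "c < n" "a \<le> N" "2 * M \<le> d" "d \<le> N"
  obtains i where "i < l" "double_omission M g c (a + i * d)"
  using assms unfolding hits_progressions_def by (metis atLeastAtMost_iff)

lemma mono_wave_gap_ge:
  assumes mono: "mono_wave k (block_coloring M g \<phi>) c w" and free: "wave_free m M \<phi>"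
    and hits: "hits_progressions n M l N g" and "c < n" "0 < M" "2 * M \<le> N" "w 0 < N"
    and index: "Suc (2 * l * m) < k"
  shows "2 * M \<le> gap w (2 * l * m)"
proof -
  let ?a = "w 0 div M * M"
  have "?a \<le> N" using div_times_less_eq_dividend[of "w 0" M] \<open>w 0 < N\<close> by linarith
  then obtain i where "i < l" and omit: "double_omission M g c (?a + i * (2 * M))"
    using hits_progressionsE[OF hits \<open>c < n\<close> _ order_refl \<open>2 * M \<le> N\<close>] by metis
  have "?a + i * (2 * M) = (w 0 div M + 2 * i) * M" by (simp add: algebra_simps)
  then have "(?a + i * (2 * M)) div M = w 0 div M + 2 * i" using \<open>0 < M\<close> by simp
  moreover have "w 0 div M + 2 * l \<le> w (2 * l * m) div M"
    using index by (intro mono_wave_climbs_blocks[OF mono free \<open>0 < M\<close>]) simp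
  ultimately show ?thesis
    using \<open>i < l\<close> by (intro double_omission_gap[OF mono \<open>0 < M\<close> index omit]) auto
qed

lemma mono_wave_gap_growth:
  assumes mono: "mono_wave k (block_coloring M g \<phi>) c w" and hits: "hits_progressions n M l N g"
    and "c < n" and bounded: "\<And>i. i < k \<Longrightarrow> w i < N" and index: "Suc (s + l) < k"
    and "2 * M \<le> gap w s"
  shows "l * gap w s + M < l * gap w (s + l)"
proof (rule ccontr)
  assume "\<not> ?thesis"
  then have slow: "l * gap w (s + l) \<le> l * gap w s + M" by simp
  have wave: "wave k w" using mono by (simp add: mono_wave_def)
  have "w s \<le> N" using bounded[of s] index by simp
  moreover have "gap w s \<le> N"
    using bounded[of "Suc s"] index by (simp add: gap_def)
  ultimately obtain i where "i < l" and omit: "double_omission M g c (w s + i * gap w s)"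
    using hits_progressionsE[OF hits \<open>c < n\<close> _ \<open>2 * M \<le> gap w s\<close>] by metis
  then have "g (w (s + i) div M) = c"
    using index slow
    by (intro double_omission_near[OF omit] wave_lower[OF wave]
        wave_near_progression[OF wave index]) auto
  then show False
    using mono_wave_avoids[OF mono, of "s + i"] \<open>i < l\<close> index by simp
qed

lemma wave_free_block_coloring:
  assumes colors: "\<And>x. x < M \<Longrightarrow> \<phi> x < r" and free: "wave_free m M \<phi>"
    and hits: "hits_progressions (Suc r) M l N g"
    and "0 < M" "2 * M \<le> N" and length: "3 * l * m + m < k" and short: "l * N < m\<^sup>2 * M"
  shows "wave_free k N (block_coloring M g \<phi>)"
  unfolding wave_free_def
proof (intro notI, elim exE conjE)
  fix w c
  assume mono: "mono_wave k (block_coloring M g \<phi>) c w" and bounded: "\<forall>i<k. w i < N"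
  have wave: "wave k w" using mono by (simp add: mono_wave_def)
  have "block_coloring M g \<phi> (w 0) = c" using mono length by (simp add: mono_wave_def)
  then have "c < Suc r"
    using colors \<open>0 < M\<close> by (auto simp: block_coloring_def intro: skip_less)
  have "0 < m" using short by (auto intro: Nat.gr0I)
  have gap_start: "2 * M \<le> gap w (2 * l * m)"
    using \<open>0 < m\<close> length \<open>c < Suc r\<close> bounded \<open>0 < M\<close> \<open>2 * M \<le> N\<close>
    by (intro mono_wave_gap_ge[OF mono free hits]) auto
  obtain s where s: "2 * l * m \<le> s" "s + l \<le> 2 * l * m + m * l"
    and slow: "l * gap w (s + l) \<le> l * gap w s + M"
  proof (rule wave_slow_window[OF wave])
    show "2 * l * m + m * l + m < k" using length by simp
    show "l * N < m * m * M" using short by (simp add: power2_eq_square)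
  qed (use bounded in \<open>auto intro: less_imp_le\<close>)
  have index: "Suc (s + l) < k" using s(2) length \<open>0 < m\<close> by simp
  have "2 * M \<le> gap w s"
    using gap_start wave_gap_mono[OF wave s(1)] index by simp
  then have "l * gap w s + M < l * gap w (s + l)"
    using bounded index by (intro mono_wave_gap_growth[OF mono hits \<open>c < Suc r\<close>]) auto
  with slow show False by simp
qed

section \<open>Choosing the omitted colors at random\<close>

lemma card_PiE_Un_le:
  assumes "finite P" "finite Q"
  shows "card {g \<in> PiE (S \<union> T) F. restrict g S \<in> P \<and> restrict g T \<in> Q} \<le> card P * card Q"
    (is "card ?G \<le> _")
proof -
  let ?h = "\<lambda>g. (restrict g S, restrict g T)"
  have "inj_on ?h ?G"
  proof (rule inj_onI)
    fix g g' assume g: "g \<in> ?G" "g' \<in> ?G" and "?h g = ?h g'"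
    then have "g x = g' x" if "x \<in> S \<union> T" for x
      using that by (metis Un_iff prod.inject restrict_apply')
    with g show "g = g'" by (intro PiE_ext[of g "S \<union> T" F g']) auto
  qed
  then have "card ?G \<le> card (P \<times> Q)"
    using assms by (intro card_inj_on_le[of ?h]) auto
  then show ?thesis by (simp add: card_cartesian_product)
qed

lemma card_PiE_avoid_pattern_le:
  assumes "finite A" "finite C" "S \<subseteq> A" "p \<in> S \<rightarrow> C"
    and restrict_closed: "\<And>g. Q g \<Longrightarrow> Q (restrict g (A - S))"
  shows "card {g \<in> A \<rightarrow>\<^sub>E C. (\<exists>x\<in>S. g x \<noteq> p x) \<and> Q g}
           \<le> (card C ^ card S - 1) * card {g \<in> A - S \<rightarrow>\<^sub>E C. Q g}"
    (is "card ?G \<le> _ * card ?R")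
proof -
  define P where "P = (S \<rightarrow>\<^sub>E C) - {restrict p S}"
  let ?H = "{g \<in> (S \<union> (A - S)) \<rightarrow>\<^sub>E C. restrict g S \<in> P \<and> restrict g (A - S) \<in> ?R}"
  have "finite S" using assms(1,3) finite_subset by blast
  then have "finite (S \<rightarrow>\<^sub>E C)" "card P = card C ^ card S - 1"
    using assms(2,4) by (auto simp: P_def card_Diff_singleton card_PiE finite_PiE)
  have union: "S \<union> (A - S) = A" using assms(3) by auto
  have "?G \<subseteq> ?H"
  proof
    fix g assume g: "g \<in> ?G"
    then obtain x where "x \<in> S" "g x \<noteq> p x" by blast
    then have "restrict g S \<noteq> restrict p S" by (metis restrict_apply')
    moreover have "Q (restrict g (A - S))" using g by (intro restrict_closed) simp
    ultimately show "g \<in> ?H" using g assms(3) unfolding union by (auto simp: P_def PiE_iff)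
  qed
  moreover have "finite ?H"
    using assms(1,2) unfolding union
    by (intro finite_subset[OF _ finite_PiE[of A "\<lambda>_. C"]]) auto
  ultimately have "card ?G \<le> card ?H" by (rule card_mono[rotated])
  also have "\<dots> \<le> card P * card ?R"
  proof (rule card_PiE_Un_le)
    show "finite P" using \<open>finite (S \<rightarrow>\<^sub>E C)\<close> by (simp add: P_def)
    show "finite ?R"
      using assms(1,2) by (intro finite_subset[OF _ finite_PiE[of "A - S" "\<lambda>_. C"]]) auto
  qed
  finally show ?thesis by (simp only: \<open>card P = card C ^ card S - 1\<close>)
qed

lemma card_PiE_avoid_patterns_le:
  assumes "finite J" "finite A" "finite C" "C \<noteq> {}" "p \<in> A \<rightarrow> C"
    and "\<And>j. j \<in> J \<Longrightarrow> S j \<subseteq> A \<and> card (S j) = k" "disjoint_family_on S J"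
  shows "real (card {g \<in> A \<rightarrow>\<^sub>E C. \<forall>j\<in>J. \<exists>x\<in>S j. g x \<noteq> p x})
           \<le> (1 - 1 / real (card C) ^ k) ^ card J * real (card C) ^ card A"
  using assms(1,2,5-)
proof (induction J arbitrary: A rule: finite_induct)
  case empty
  then show ?case by (simp add: card_PiE)
next
  case (insert j J)
  let ?n = "real (card C)"
  let ?Q = "\<lambda>g. \<forall>i\<in>J. \<exists>x\<in>S i. g x \<noteq> p x"
  have subset: "S j \<subseteq> A" and size: "card (S j) = k" using insert.prems(3) by auto
  have card_A: "card A = k + card (A - S j)"
    using size card_mono[OF insert.prems(1) subset] finite_subset[OF subset insert.prems(1)]
    by (simp add: card_Diff_subset[OF _ subset])
  have remain: "S i \<subseteq> A - S j" if "i \<in> J" for i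
    using insert.prems(3)[of i] disjoint_family_onD[OF insert.prems(4), of i j]
      insert.hyps(2) that by auto
  have "0 < card C" using assms(3,4) by (simp add: card_gt_0_iff)
  then have coeff: "real (card C ^ k - 1) = (1 - 1 / ?n ^ k) * ?n ^ k"
    by (simp add: Suc_le_eq left_diff_distrib)
  have "?Q (restrict g (A - S j))" if "?Q g" for g
    using that remain by (metis restrict_apply' subsetD)
  then have "card {g \<in> A \<rightarrow>\<^sub>E C. (\<exists>x\<in>S j. g x \<noteq> p x) \<and> ?Q g}
      \<le> (card C ^ k - 1) * card {g \<in> A - S j \<rightarrow>\<^sub>E C. ?Q g}" (is "?c \<le> _ * ?d")
    using card_PiE_avoid_pattern_le[OF insert.prems(1) assms(3) subset, of p ?Q]
      insert.prems(2) subset size by fastforce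
  then have "real ?c \<le> real ((card C ^ k - 1) * ?d)" by (rule of_nat_mono)
  also have "\<dots> = real (card C ^ k - 1) * real ?d" by (rule of_nat_mult)
  also have "\<dots> \<le> real (card C ^ k - 1) * ((1 - 1 / ?n ^ k) ^ card J * ?n ^ card (A - S j))"
    using insert.prems remain
    by (intro mult_left_mono insert.IH) (auto simp: disjoint_family_on_def)
  also have "\<dots> = (1 - 1 / ?n ^ k) ^ card (insert j J) * ?n ^ card A"
    unfolding coeff using insert.hyps by (simp add: card_A power_add)
  finally show ?case by simp
qed

lemma card_no_double_omission_le:
  assumes "0 < M" "2 * M \<le> d" and "finite A" "c < n"
    and contained: "\<And>i. i < l \<Longrightarrow> {(a + i * d) div M, Suc ((a + i * d) div M)} \<subseteq> A"
  shows "real (card {g \<in> A \<rightarrow>\<^sub>E {..<n}. \<forall>i<l. \<not> double_omission M g c (a + i * d)})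
           \<le> (1 - 1 / real n ^ 2) ^ l * real n ^ card A"
proof -
  define S where "S i = {(a + i * d) div M, Suc ((a + i * d) div M)}" for i
  have far: "(a + i * d) div M + 2 \<le> (a + j * d) div M" if "i < j" for i j
  proof -
    have "Suc i * d \<le> j * d" using that by (intro mult_le_mono1) simp
    then have "a + i * d + 2 * M \<le> a + j * d" using \<open>2 * M \<le> d\<close> by simp
    then show ?thesis using div_le_mono[of "a + i * d + 2 * M" "a + j * d" M] \<open>0 < M\<close> by simp
  qed
  have "disjoint_family_on S {..<l}"
    unfolding disjoint_family_on_def
  proof (intro ballI impI)
    fix i j :: nat assume "i \<noteq> j"
    then show "S i \<inter> S j = {}"
      using far[of i j] far[of j i] by (cases i j rule: linorder_cases) (auto simp: S_def)
  qed
  moreover have "S i \<subseteq> A \<and> card (S i) = 2" if "i < l" for i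
    using contained[OF that] by (simp add: S_def)
  ultimately have "real (card {g \<in> A \<rightarrow>\<^sub>E {..<n}. \<forall>i\<in>{..<l}. \<exists>x\<in>S i. g x \<noteq> c})
      \<le> (1 - 1 / real (card {..<n}) ^ 2) ^ card {..<l} * real (card {..<n}) ^ card A"
    using \<open>finite A\<close> \<open>c < n\<close> by (intro card_PiE_avoid_patterns_le) auto
  then show ?thesis by (simp add: S_def double_omission_def Ball_def)
qed

lemma union_bound_exists:
  assumes "finite I" "finite F" "F \<noteq> {}"
    and bad: "\<And>p. p \<in> I \<Longrightarrow> real (card {g \<in> F. bad p g}) \<le> q * real (card F)"
    and "real (card I) * q < 1"
  shows "\<exists>g\<in>F. \<forall>p\<in>I. \<not> bad p g"
proof (rule ccontr)
  assume "\<not> ?thesis"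
  then have "F \<subseteq> (\<Union>p\<in>I. {g \<in> F. bad p g})" by blast
  then have "card F \<le> card (\<Union>p\<in>I. {g \<in> F. bad p g})"
    using assms(1,2) by (intro card_mono) auto
  also have "\<dots> \<le> (\<Sum>p\<in>I. card {g \<in> F. bad p g})"
    by (rule card_UN_le[OF assms(1)])
  finally have "real (card F) \<le> real (\<Sum>p\<in>I. card {g \<in> F. bad p g})"
    by (rule of_nat_mono)
  also have "\<dots> = (\<Sum>p\<in>I. real (card {g \<in> F. bad p g}))" by (rule of_nat_sum)
  also have "\<dots> \<le> (\<Sum>p\<in>I. q * real (card F))" by (intro sum_mono bad)
  also have "\<dots> = real (card I) * q * real (card F)" by simp
  also have "\<dots> < 1 * real (card F)"
    using assms by (intro mult_strict_right_mono) (auto simp: card_gt_0_iff)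
  finally show False by simp
qed

lemma hits_progressions_exists:
  assumes "0 < M" "0 < n" and small: "real n * (real N + 1)\<^sup>2 * (1 - 1 / real n ^ 2) ^ l < 1"
  obtains g where "hits_progressions n M l N g"
proof -
  define A where "A = {..Suc (N + l * N)}"
  define I where "I = {..<n} \<times> {..N} \<times> {2 * M..N}"
  define q where "q = (1 - 1 / real n ^ 2) ^ l"
  let ?F = "A \<rightarrow>\<^sub>E {..<n}"
  define bad where "bad = (\<lambda>(c, a, d) g. \<forall>i<l. \<not> double_omission M g c (a + i * d))"
  have rare: "real (card {g \<in> ?F. bad p g}) \<le> q * real (card ?F)" if "p \<in> I" for p
  proof -
    obtain c a d where p: "p = (c, a, d)" "c < n" "a \<le> N" "2 * M \<le> d" "d \<le> N"
      using \<open>p \<in> I\<close> by (auto simp: I_def)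
    have "(a + i * d) div M \<le> N + l * N" if "i < l" for i
      using p that by (intro order_trans[OF div_le_dividend] add_mono mult_le_mono) auto
    then show ?thesis
      using card_no_double_omission_le[of M d A c n l a] assms(1) p
      by (simp add: bad_def q_def card_PiE A_def le_SucI)
  qed
  have "card I \<le> card ({..<n} \<times> {..N} \<times> {..N})"
    unfolding I_def by (intro card_mono) auto
  then have "card I \<le> n * (Suc N)\<^sup>2"
    by (simp add: power2_eq_square)
  then have "real (card I) \<le> real (n * (Suc N)\<^sup>2)" by (rule of_nat_mono)
  also have "\<dots> = real n * (real N + 1)\<^sup>2" by simp
  finally have "real (card I) * q \<le> real n * (real N + 1)\<^sup>2 * q"
    using assms(2) by (intro mult_right_mono) (auto simp: q_def)
  then have few: "real (card I) * q < 1" using small by (simp add: q_def)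
  have "finite I" "finite ?F" "?F \<noteq> {}"
    using assms(2) by (auto simp: I_def A_def finite_PiE PiE_eq_empty_iff)
  then have "\<exists>g\<in>?F. \<forall>p\<in>I. \<not> bad p g"
    using rare few by (rule union_bound_exists)
  then obtain g where avoids: "\<And>p. p \<in> I \<Longrightarrow> \<not> bad p g" by blast
  have "\<exists>i<l. double_omission M g c (a + i * d)" if "c < n" "a \<le> N" "d \<in> {2 * M..N}" for c a d
    using avoids[of "(c, a, d)"] that by (simp add: I_def bad_def)
  then show ?thesis
    by (intro that[of g]) (simp add: hits_progressions_def)
qed

section \<open>Adding a color\<close>

lemma wave_colorable_Suc:
  assumes "wave_colorable m r M" "0 < M" "2 * M \<le> N" "3 * l * m + m < k" "l * N < m\<^sup>2 * M"
    and union_bound: "real (Suc r) * (real N + 1)\<^sup>2 * (1 - 1 / real (Suc r) ^ 2) ^ l < 1"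
  shows "wave_colorable k (Suc r) N"
proof -
  obtain \<phi> where colors: "\<And>x. x < M \<Longrightarrow> \<phi> x < r" and free: "wave_free m M \<phi>"
    using assms(1) unfolding wave_colorable_def by blast
  obtain g where "hits_progressions (Suc r) M l N g"
    using hits_progressions_exists[OF \<open>0 < M\<close> _ union_bound] by blast
  then have "wave_free k N (block_coloring M g \<phi>)"
    using assms by (intro wave_free_block_coloring[OF colors free])
  moreover have "block_coloring M g \<phi> x < Suc r" for x
    using colors \<open>0 < M\<close> by (simp add: block_coloring_def skip_less)
  ultimately show ?thesis
    unfolding wave_colorable_def by blast
qed

lemma eventually_wave_colorable_Suc:
  assumes "1 \<le> r" and exponents: "0 < d" "d < 1 / 8" "0 < u" "u < s" "0 < v"
      "u < (1 - 2 * d) * v" "s < 2 - 5 * d + u"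
    and colorable: "\<forall>\<^sub>F k in sequentially. wave_colorable k r (nat \<lceil>real k powr v\<rceil>)"
  shows "\<forall>\<^sub>F k in sequentially. wave_colorable k (Suc r) (nat \<lceil>real k powr s\<rceil>)"
proof -
  define l m M N where "l k = nat \<lfloor>real k powr d\<rfloor>" and "m k = nat \<lfloor>real k powr (1 - 2 * d)\<rfloor>"
    and "M k = nat \<lceil>real k powr u\<rceil>" and "N k = nat \<lceil>real k powr s\<rceil>" for k :: nat
  note defs = l_def m_def M_def N_def
  have "filterlim m at_top sequentially" unfolding defs using exponents by real_asymp
  then have "\<forall>\<^sub>F k in sequentially. wave_colorable (m k) r (nat \<lceil>real (m k) powr v\<rceil>)"
    using colorable by (rule eventually_compose_filterlim[rotated])
  moreover have "\<forall>\<^sub>F k in sequentially. M k \<le> nat \<lceil>real (m k) powr v\<rceil>"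
    unfolding defs using exponents by real_asymp
  ultimately have "\<forall>\<^sub>F k in sequentially. wave_colorable (m k) r (M k)"
    by eventually_elim (rule wave_colorable_mono)
  moreover have "\<forall>\<^sub>F k in sequentially. 0 < M k"
    unfolding defs using exponents by real_asymp
  moreover have "\<forall>\<^sub>F k in sequentially. 2 * M k \<le> N k"
    unfolding defs using exponents by real_asymp
  moreover have "\<forall>\<^sub>F k in sequentially. 3 * l k * m k + m k < k"
    unfolding defs using exponents by real_asymp
  moreover have "\<forall>\<^sub>F k in sequentially. l k * N k < (m k)\<^sup>2 * M k"
    unfolding defs using exponents by real_asymp
  moreover have "\<forall>\<^sub>F k in sequentially.
      real (Suc r) * (real (N k) + 1)\<^sup>2 * (1 - 1 / real (Suc r) ^ 2) ^ l k < 1"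
  proof -
    define q where "q = 1 - 1 / real (Suc r) ^ 2"
    have "0 < q" "q < 1" using \<open>1 \<le> r\<close> by (auto simp: q_def)
    then show ?thesis
      unfolding q_def[symmetric] defs using exponents by real_asymp
  qed
  ultimately show ?thesis
    unfolding N_def[symmetric] by eventually_elim (rule wave_colorable_Suc)
qed

lemma eventually_wave_colorable:
  assumes "1 \<le> r" "0 < s" "s < 2 * real r - 1"
  shows "\<forall>\<^sub>F k in sequentially. wave_colorable k r (nat \<lceil>real k powr s\<rceil>)"
  using assms
proof (induction r arbitrary: s rule: nat_induct_at_least)
  case base
  then have "\<forall>\<^sub>F k in sequentially. nat \<lceil>real k powr s\<rceil> < k" by real_asymp
  then show ?case by eventually_elim (rule wave_colorable_one)
next
  case (Suc r)
  have "max (s - 2) 0 < min s (2 * real r - 1)" using Suc.prems Suc.hyps by auto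
  then obtain u where "max (s - 2) 0 < u" "u < min s (2 * real r - 1)"
    using dense by blast
  then have u: "s < 2 + u" "0 < u" "u < s" "u < 2 * real r - 1" by auto
  then obtain v where v: "u < v" "v < 2 * real r - 1"
    using dense[of u "2 * real r - 1"] by auto
  have "\<forall>\<^sub>F d in at_right 0. 0 < d \<and> d < 1 / 8 \<and> u < (1 - 2 * d) * v \<and> s < 2 - 5 * d + u"
    by (intro eventually_conj) (use u v in real_asymp)+
  then obtain d where "0 < d" "d < 1 / 8" "u < (1 - 2 * d) * v" "s < 2 - 5 * d + u"
    using eventually_happens trivial_limit_at_right_real by blast
  with u v Suc.hyps Suc.IH[of v] show ?case
    by (intro eventually_wave_colorable_Suc[of r d u s v]) auto
qed

theorem theorem2:
  fixes r :: nat and \<epsilon> :: real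
  assumes "r \<ge> 1" and "\<epsilon> > 0"
  shows "\<forall>\<^sub>F k in sequentially.
           real (AW k r) \<ge> real k powr (2 * real r - 1 - \<epsilon>)
              / (2 ^ (r - 1) * (40 * real r) ^ (r ^ 2 - 1))"
proof -
  define s where "s = max (2 * real r - 1 - \<epsilon>) (1 / 2)"
  have "\<forall>\<^sub>F k in sequentially. wave_colorable k r (nat \<lceil>real k powr s\<rceil>)"
    using assms by (intro eventually_wave_colorable) (auto simp: s_def)
  then show ?thesis
    using eventually_ge_at_top[of 1]
  proof eventually_elim
    case (elim k)
    have "(1::real) \<le> 2 ^ (r - 1) * (40 * real r) ^ (r\<^sup>2 - 1)"
      using assms(1) by (intro mult_ge1_I one_le_power) auto
    then have "real k powr (2 * real r - 1 - \<epsilon>) / (2 ^ (r - 1) * (40 * real r) ^ (r\<^sup>2 - 1))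
        \<le> real k powr (2 * real r - 1 - \<epsilon>) / 1"
      by (intro divide_left_mono) auto
    also have "\<dots> \<le> real k powr s"
      using elim(2) by (simp add: s_def powr_mono)
    also have "\<dots> \<le> real (AW k r)"
      using less_AW[OF elim(1)] by linarith
    finally show ?case .
  qed
qed

end
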